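(* Let $G$ be a graph and let $l$ be a positive integer. Then $G$ is derangement $l$-representable if and only if $G$ is isomorphic to an induced subgraph of $\Gamma=\mathrm{Cay}(S_l,D_l)$.
   Context: All graphs are finite, simple and undirected. For a positive integer $l$, $[l]=\{1,\dots,l\}$, $S_l$ is the group of all permutations of $[l]$ (with composition of functions), and $D_l\subseteq S_l$ is the set of derangements, i.e. permutations $\sigma$ with $\sigma(i)\neq i$ for all $i\in[l]$. A graph $G$ is derangement $l$-representable if there is an injective map $\pi:V(G)\to S_l$ such that for any two (distinct) vertices $u,v$ of $G$, $u$ and $v$ are adjacent if and only if $\pi(v)(i)\neq\pi(u)(i)$ for all $i\in[l]$ (equivalently, $\pi(v)^{-1}\circ\pi(u)\in D_l$). For a group $\mathcal{G}$ and a subset $S\subseteq\mathcal{G}$ with $1\notin S$ and $S=S^{-1}$, the Cayley graph $\mathrm{Cay}(\mathcal{G},S)$ has vertex set $\mathcal{G}$, with an edge joining $g$ and $h$ if and only if $h=sg$ for some $s\in S$. *)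

theory Defs
  imports "HOL-Algebra.Sym_Groups" "Graph_Theory.Digraph_Isomorphism"
begin

text \<open>
  A finite simple undirected graph is a \<^locale>\<open>graph\<close>, i.e. a finite, symmetric digraph without
  loops and parallel arcs; two vertices are adjacent iff one dominates the other.
  The symmetric group on \<open>{1..l}\<close> is \<^const>\<open>sym_group\<close>, whose elements are the functions on the
  natural numbers that permute \<open>{1..l}\<close> and fix everything else.
\<close>

definition derangements :: "nat \<Rightarrow> (nat \<Rightarrow> nat) set" where
  "derangements l = {\<sigma> \<in> carrier (sym_group l). \<forall>i\<in>{1..l}. \<sigma> i \<noteq> i}"

definition derangement_representable :: "nat \<Rightarrow> ('a, 'b) pre_digraph \<Rightarrow> bool" where
  "derangement_representable l G \<longleftrightarrow>
     (\<exists>\<pi>. \<pi> ` verts G \<subseteq> carrier (sym_group l) \<and> inj_on \<pi> (verts G) \<and>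
          (\<forall>u\<in>verts G. \<forall>v\<in>verts G. u \<noteq> v \<longrightarrow>
             (u \<rightarrow>\<^bsub>G\<^esub> v \<longleftrightarrow> (\<forall>i\<in>{1..l}. \<pi> v i \<noteq> \<pi> u i))))"

text \<open>
  An edge between \<open>g\<close> and \<open>h\<close> is the pair of arcs \<open>(g, h)\<close> and \<open>(h, g)\<close>; this is a graph when
  \<open>S\<close> is closed under inverses and does not contain the unit, see below.
\<close>

definition cayley_graph ::
    "('g, 'm) monoid_scheme \<Rightarrow> 'g set \<Rightarrow> ('g, 'g \<times> 'g) pre_digraph" where
  "cayley_graph \<G> S =
     \<lparr>verts = carrier \<G>,
      arcs = {(g, h). g \<in> carrier \<G> \<and> h \<in> carrier \<G> \<and> (\<exists>s\<in>S. h = s \<otimes>\<^bsub>\<G>\<^esub> g)},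
      tail = fst, head = snd\<rparr>"

lemma graph_cayley_graph:
  fixes \<G> (structure)
  assumes "group \<G>" and fin: "finite (carrier \<G>)" and S: "S \<subseteq> carrier \<G>"
    and one: "\<one> \<notin> S" and inv: "\<And>s. s \<in> S \<Longrightarrow> inv\<^bsub>\<G>\<^esub> s \<in> S"
  shows "graph (cayley_graph \<G> S)"
proof -
  interpret group \<G> by fact
  let ?C = "cayley_graph \<G> S"
  have sym: "(h, g) \<in> arcs ?C" if "(g, h) \<in> arcs ?C" for g h
  proof -
    from that obtain s where s: "g \<in> carrier \<G>" "h \<in> carrier \<G>" "s \<in> S" "h = s \<otimes> g"
      unfolding cayley_graph_def by simp blast
    then have "s \<in> carrier \<G>" using S by auto
    with s have "g = inv\<^bsub>\<G>\<^esub> s \<otimes> h"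
      using inv_solve_left by blast
    moreover have "inv\<^bsub>\<G>\<^esub> s \<in> S"
      using s by (intro inv)
    ultimately have "\<exists>t\<in>S. g = t \<otimes> h" ..
    then show ?thesis using s(1,2) by (simp add: cayley_graph_def)
  qed
  have noloop: "g \<noteq> h" if "(g, h) \<in> arcs ?C" for g h
  proof
    assume "g = h"
    with that obtain s where s: "g \<in> carrier \<G>" "s \<in> S" "g = s \<otimes> g"
      unfolding cayley_graph_def by simp blast
    then have "s \<in> carrier \<G>" using S by blast
    with s have "s = \<one>" using r_cancel_one' by blast
    with s(2) one show False by simp
  qed
  have "arcs ?C \<subseteq> carrier \<G> \<times> carrier \<G>"
    by (auto simp: cayley_graph_def)
  then have finarcs: "finite (arcs ?C)"
    using fin by (meson finite_SigmaI finite_subset)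
  have [simp]: "tail ?C = fst" "head ?C = snd" "verts ?C = carrier \<G>"
    by (simp_all add: cayley_graph_def)
  show ?thesis
  proof
    fix e assume e: "e \<in> arcs ?C"
    show "tail ?C e \<in> verts ?C" "head ?C e \<in> verts ?C"
      using e by (auto simp: cayley_graph_def)
    show "tail ?C e \<noteq> head ?C e"
      using e noloop[of "fst e" "snd e"] by simp
  next
    show "finite (verts ?C)" using fin by simp
    show "finite (arcs ?C)" by (fact finarcs)
  next
    fix e1 e2 assume "arc_to_ends ?C e1 = arc_to_ends ?C e2"
    then show "e1 = e2" by (simp add: arc_to_ends_def)
  next
    have "arcs_ends ?C = arcs ?C"
      by (simp add: arcs_ends_conv)
    then show "symmetric ?C"
      unfolding symmetric_def by (metis sym symI)
  qed
qed

lemma one_notin_derangements: "l > 0 \<Longrightarrow> \<one>\<^bsub>sym_group l\<^esub> \<notin> derangements l"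
  by (auto simp: derangements_def sym_group_one)

lemma inv_derangements:
  assumes "\<sigma> \<in> derangements l"
  shows "inv\<^bsub>sym_group l\<^esub> \<sigma> \<in> derangements l"
proof -
  have p: "\<sigma> permutes {1..l}" and d: "\<forall>i\<in>{1..l}. \<sigma> i \<noteq> i"
    using assms by (auto simp: derangements_def sym_group_carrier)
  have "inv\<^bsub>sym_group l\<^esub> \<sigma> = inv' \<sigma>"
    using p by (simp add: sym_group_inv_equality sym_group_carrier)
  moreover have "inv' \<sigma> i \<noteq> i" if "i \<in> {1..l}" for i
    using d that p by (metis permutes_inverses(1))
  ultimately show ?thesis
    using p by (auto simp: derangements_def sym_group_carrier permutes_inv)
qed

lemma graph_cayley_derangements:
  assumes "l > 0"
  shows "graph (cayley_graph (sym_group l) (derangements l))"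
proof (rule graph_cayley_graph)
  show "finite (carrier (sym_group l))"
    by (simp add: sym_group_def finite_permutations)
  show "derangements l \<subseteq> carrier (sym_group l)"
    by (auto simp: derangements_def)
qed (use assms in \<open>simp_all add: sym_group_is_group one_notin_derangements inv_derangements\<close>)

end

theory Submission
  imports Defs
begin

text \<open>
  A representation \<open>\<pi>\<close> is exactly an embedding of \<open>G\<close> into the Cayley graph \<open>\<Gamma>\<close>: there is an arc from
  \<open>\<sigma>\<close> to \<open>\<tau>\<close> in \<open>\<Gamma>\<close> iff \<open>\<tau> \<circ> inv \<sigma>\<close> is a derangement (\<open>dominates_cayley_graph_iff\<close>), and substituting
  \<open>i = \<sigma> j\<close> in \<open>\<tau> (inv \<sigma> i) \<noteq> i\<close> turns this into \<open>\<tau> j \<noteq> \<sigma> j\<close> for all \<open>j\<close>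
  (\<open>derangement_quotient_iff\<close>).

  It remains to pass between embeddings, which are maps of vertices, and isomorphisms onto induced
  subgraphs, which also map arcs. In graphs without parallel arcs an arc is determined by its ends,
  so an embedding of the vertices extends uniquely to the arcs
  (\<open>iso_induced_subgraph_iff_embedding\<close>).
\<close>

lemma dominates_induced_subgraph_iff:
  assumes "induced_subgraph H C" and "x \<in> verts H" "y \<in> verts H"
  shows "x \<rightarrow>\<^bsub>H\<^esub> y \<longleftrightarrow> x \<rightarrow>\<^bsub>C\<^esub> y"
  using assms by (auto simp: induced_subgraph_def subgraph_def compatible_def arcs_ends_conv)

lemma (in wf_digraph) dominates_app_iso_iff:
  assumes "digraph_isomorphism f" and "u \<in> verts G" "v \<in> verts G"
  shows "iso_verts f u \<rightarrow>\<^bsub>app_iso f G\<^esub> iso_verts f v \<longleftrightarrow> u \<rightarrow> v"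
proof
  assume "iso_verts f u \<rightarrow>\<^bsub>app_iso f G\<^esub> iso_verts f v"
  then obtain u' v' where *: "u' \<rightarrow> v'" "iso_verts f u' = iso_verts f u" "iso_verts f v' = iso_verts f v"
    unfolding arcs_ends_app_iso_eq[OF assms(1)] by auto
  then have "u' = u" "v' = v"
    using assms adj_in_verts[OF *(1)] by simp_all
  with *(1) show "u \<rightarrow> v" by simp
next
  assume "u \<rightarrow> v"
  then show "iso_verts f u \<rightarrow>\<^bsub>app_iso f G\<^esub> iso_verts f v"
    unfolding arcs_ends_app_iso_eq[OF assms(1)] by force
qed

text \<open>
  The arc over a given pair of adjacent vertices exists and is unique in \<open>C\<close>; sending an arc of \<open>G\<close> to
  the arc over the images of its ends is therefore well defined, and it hits every arc between image
  vertices because \<open>\<pi>\<close> also reflects adjacency.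
\<close>

lemma digraph_iso_induce_subgraph_image:
  assumes "nomulti_digraph G" and "nomulti_digraph C"
    and into: "\<pi> ` verts G \<subseteq> verts C" and inj: "inj_on \<pi> (verts G)"
    and adj: "\<And>u v. u \<in> verts G \<Longrightarrow> v \<in> verts G \<Longrightarrow> u \<rightarrow>\<^bsub>G\<^esub> v \<longleftrightarrow> \<pi> u \<rightarrow>\<^bsub>C\<^esub> \<pi> v"
  shows "digraph_iso G (C \<restriction> (\<pi> ` verts G))"
proof -
  interpret G: nomulti_digraph G by fact
  interpret C: nomulti_digraph C by fact
  define k where
    "k e = (SOME c. c \<in> arcs C \<and> tail C c = \<pi> (tail G e) \<and> head C c = \<pi> (head G e))" for e
  have k: "k e \<in> arcs C" "tail C (k e) = \<pi> (tail G e)" "head C (k e) = \<pi> (head G e)"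
    if "e \<in> arcs G" for e
  proof -
    have "tail G e \<rightarrow>\<^bsub>G\<^esub> head G e"
      using that by (auto simp: arcs_ends_conv)
    then have "\<pi> (tail G e) \<rightarrow>\<^bsub>C\<^esub> \<pi> (head G e)"
      using that adj by simp
    then have "\<exists>c. c \<in> arcs C \<and> tail C c = \<pi> (tail G e) \<and> head C c = \<pi> (head G e)"
      by auto
    from someI_ex[OF this]
    show "k e \<in> arcs C" "tail C (k e) = \<pi> (tail G e)" "head C (k e) = \<pi> (head G e)"
      by (simp_all add: k_def)
  qed
  have inj_k: "inj_on k (arcs G)"
  proof (rule inj_onI)
    fix d e assume de: "d \<in> arcs G" "e \<in> arcs G" "k d = k e"
    then have "\<pi> (tail G d) = \<pi> (tail G e)" "\<pi> (head G d) = \<pi> (head G e)"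
      using k[of d] k[of e] by simp_all
    then have "arc_to_ends G d = arc_to_ends G e"
      using de inj by (simp add: arc_to_ends_def inj_on_eq_iff)
    with de show "d = e" by (intro G.no_multi_arcs)
  qed
  have onto: "c \<in> k ` arcs G"
    if c: "c \<in> arcs C" "tail C c \<in> \<pi> ` verts G" "head C c \<in> \<pi> ` verts G" for c
  proof -
    from c obtain u v where uv: "u \<in> verts G" "v \<in> verts G" "tail C c = \<pi> u" "head C c = \<pi> v"
      by blast
    with c(1) have "\<pi> u \<rightarrow>\<^bsub>C\<^esub> \<pi> v"
      by (force simp: arcs_ends_conv)
    with uv adj have "u \<rightarrow>\<^bsub>G\<^esub> v" by simp
    then obtain e where e: "e \<in> arcs G" "tail G e = u" "head G e = v" by auto
    then have "c = k e"
      using c(1) uv k[OF e(1)] by (intro C.no_multi_arcs) (simp_all add: arc_to_ends_def)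
    with e(1) show ?thesis by blast
  qed
  define f where "f = \<lparr>iso_verts = \<pi>, iso_arcs = k, iso_head = head C, iso_tail = tail C\<rparr>"
  have "G.digraph_isomorphism f"
    using inj inj_k k by (simp add: G.digraph_isomorphism_def f_def G.wf_digraph)
  moreover have "C \<restriction> (\<pi> ` verts G) = app_iso f G"
  proof -
    have "{c \<in> arcs C. tail C c \<in> \<pi> ` verts G \<and> head C c \<in> \<pi> ` verts G} = k ` arcs G"
      using onto k by auto
    then show ?thesis
      by (simp add: f_def app_iso_def induce_subgraph_def)
  qed
  ultimately show ?thesis
    unfolding digraph_iso_def by blast
qed

lemma iso_induced_subgraph_iff_embedding:
  assumes "nomulti_digraph G" and "nomulti_digraph C"
  shows "(\<exists>H. induced_subgraph H C \<and> digraph_iso G H) \<longleftrightarrow>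
    (\<exists>\<pi>. \<pi> ` verts G \<subseteq> verts C \<and> inj_on \<pi> (verts G) \<and>
         (\<forall>u\<in>verts G. \<forall>v\<in>verts G. u \<rightarrow>\<^bsub>G\<^esub> v \<longleftrightarrow> \<pi> u \<rightarrow>\<^bsub>C\<^esub> \<pi> v))"
    (is "?iso \<longleftrightarrow> ?emb")
proof
  interpret G: nomulti_digraph G by fact
  assume ?iso
  then obtain f where f: "G.digraph_isomorphism f" and H: "induced_subgraph (app_iso f G) C"
    unfolding digraph_iso_def by blast
  have "iso_verts f ` verts G \<subseteq> verts C"
    using H by (auto simp: induced_subgraph_def subgraph_def)
  moreover have "inj_on (iso_verts f) (verts G)"
    using f by (rule G.digraph_isomorphism_inj_on_verts)
  moreover have "u \<rightarrow>\<^bsub>G\<^esub> v \<longleftrightarrow> iso_verts f u \<rightarrow>\<^bsub>C\<^esub> iso_verts f v"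
    if "u \<in> verts G" "v \<in> verts G" for u v
    using that G.dominates_app_iso_iff[OF f that] dominates_induced_subgraph_iff[OF H] by simp
  ultimately show ?emb by blast
next
  interpret C: nomulti_digraph C by fact
  assume ?emb
  then obtain \<pi> where \<pi>: "\<pi> ` verts G \<subseteq> verts C" "inj_on \<pi> (verts G)"
      "\<And>u v. u \<in> verts G \<Longrightarrow> v \<in> verts G \<Longrightarrow> u \<rightarrow>\<^bsub>G\<^esub> v \<longleftrightarrow> \<pi> u \<rightarrow>\<^bsub>C\<^esub> \<pi> v"
    by blast
  have "induced_subgraph (C \<restriction> (\<pi> ` verts G)) C"
    using \<pi>(1) by (rule C.induced_induce)
  then show ?iso
    using digraph_iso_induce_subgraph_image[OF assms \<pi>] by blast
qed

lemma (in group) dominates_cayley_graph_iff: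
  assumes "g \<in> carrier G" "h \<in> carrier G" and "S \<subseteq> carrier G"
  shows "g \<rightarrow>\<^bsub>cayley_graph G S\<^esub> h \<longleftrightarrow> h \<otimes> inv g \<in> S"
proof -
  have "g \<rightarrow>\<^bsub>cayley_graph G S\<^esub> h \<longleftrightarrow> (\<exists>s\<in>S. h = s \<otimes> g)"
    using assms by (auto simp: arcs_ends_conv cayley_graph_def)
  also have "\<dots> \<longleftrightarrow> (\<exists>s\<in>S. s = h \<otimes> inv g)"
    using assms inv_solve_right by (metis subsetD)
  finally show ?thesis by simp
qed

lemma derangement_quotient_iff:
  assumes \<sigma>: "\<sigma> \<in> carrier (sym_group l)" and \<tau>: "\<tau> \<in> carrier (sym_group l)"
  shows "\<tau> \<otimes>\<^bsub>sym_group l\<^esub> inv\<^bsub>sym_group l\<^esub> \<sigma> \<in> derangements l \<longleftrightarrow> (\<forall>i\<in>{1..l}. \<tau> i \<noteq> \<sigma> i)"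
proof -
  interpret group "sym_group l" by (rule sym_group_is_group)
  have p: "\<sigma> permutes {1..l}"
    using \<sigma> by (simp add: sym_group_carrier)
  have q: "(\<tau> \<otimes>\<^bsub>sym_group l\<^esub> inv\<^bsub>sym_group l\<^esub> \<sigma>) i = \<tau> (inv' \<sigma> i)" for i
    using \<sigma> by (simp add: sym_group_mult sym_group_inv_equality)
  have "\<tau> \<otimes>\<^bsub>sym_group l\<^esub> inv\<^bsub>sym_group l\<^esub> \<sigma> \<in> carrier (sym_group l)"
    using \<sigma> \<tau> by (intro m_closed inv_closed)
  then have "\<tau> \<otimes>\<^bsub>sym_group l\<^esub> inv\<^bsub>sym_group l\<^esub> \<sigma> \<in> derangements l \<longleftrightarrow>
      (\<forall>i\<in>{1..l}. \<tau> (inv' \<sigma> i) \<noteq> i)"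
    unfolding derangements_def by (simp add: q)
  also have "\<dots> \<longleftrightarrow> (\<forall>i\<in>\<sigma> ` {1..l}. \<tau> (inv' \<sigma> i) \<noteq> i)"
    using permutes_image[OF p] by simp
  also have "\<dots> \<longleftrightarrow> (\<forall>i\<in>{1..l}. \<tau> i \<noteq> \<sigma> i)"
    using permutes_inverses(2)[OF p] by simp
  finally show ?thesis .
qed

text \<open>
  A representation constrains only pairs of distinct vertices, an embedding all pairs. On the diagonal
  both sides of the equivalence are false: \<open>G\<close> has no loops, and neither has the Cayley graph when
  \<open>l > 0\<close>. For \<open>l = 0\<close> the only permutation is vacuously a derangement, which would create a loop.
\<close>

theorem theorem3:
  fixes G :: "('a, 'b) pre_digraph" and l :: nat
  assumes "graph G" and "l > 0"
  shows "derangement_representable l G \<longleftrightarrow>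
    (\<exists>H. induced_subgraph H (cayley_graph (sym_group l) (derangements l)) \<and> digraph_iso G H)"
proof -
  let ?C = "cayley_graph (sym_group l) (derangements l)"
  interpret G: graph G by fact
  interpret C: graph ?C using \<open>l > 0\<close> by (rule graph_cayley_derangements)
  interpret S: group "sym_group l" by (rule sym_group_is_group)
  have verts: "verts ?C = carrier (sym_group l)"
    by (simp add: cayley_graph_def)
  have adj: "\<sigma> \<rightarrow>\<^bsub>?C\<^esub> \<tau> \<longleftrightarrow> (\<forall>i\<in>{1..l}. \<tau> i \<noteq> \<sigma> i)"
    if "\<sigma> \<in> carrier (sym_group l)" "\<tau> \<in> carrier (sym_group l)" for \<sigma> \<tau>
  proof -
    have "derangements l \<subseteq> carrier (sym_group l)"
      by (auto simp: derangements_def)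
    with that show ?thesis
      by (simp only: S.dominates_cayley_graph_iff derangement_quotient_iff)
  qed
  have "(\<forall>u\<in>verts G. \<forall>v\<in>verts G. u \<noteq> v \<longrightarrow> (u \<rightarrow>\<^bsub>G\<^esub> v \<longleftrightarrow> (\<forall>i\<in>{1..l}. \<pi> v i \<noteq> \<pi> u i))) \<longleftrightarrow>
      (\<forall>u\<in>verts G. \<forall>v\<in>verts G. u \<rightarrow>\<^bsub>G\<^esub> v \<longleftrightarrow> \<pi> u \<rightarrow>\<^bsub>?C\<^esub> \<pi> v)"
    if "\<pi> ` verts G \<subseteq> carrier (sym_group l)" for \<pi>
  proof (intro ball_cong refl)
    fix u v assume uv: "u \<in> verts G" "v \<in> verts G"
    then have \<pi>: "\<pi> u \<rightarrow>\<^bsub>?C\<^esub> \<pi> v \<longleftrightarrow> (\<forall>i\<in>{1..l}. \<pi> v i \<noteq> \<pi> u i)"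
      using that by (intro adj) auto
    have "\<not> u \<rightarrow>\<^bsub>G\<^esub> u" "\<not> \<pi> u \<rightarrow>\<^bsub>?C\<^esub> \<pi> u"
      using G.adj_not_same C.adj_not_same by blast+
    then show "(u \<noteq> v \<longrightarrow> (u \<rightarrow>\<^bsub>G\<^esub> v \<longleftrightarrow> (\<forall>i\<in>{1..l}. \<pi> v i \<noteq> \<pi> u i))) \<longleftrightarrow>
        (u \<rightarrow>\<^bsub>G\<^esub> v \<longleftrightarrow> \<pi> u \<rightarrow>\<^bsub>?C\<^esub> \<pi> v)"
      unfolding \<pi>[symmetric] by auto
  qed
  then have "derangement_representable l G \<longleftrightarrow>
      (\<exists>\<pi>. \<pi> ` verts G \<subseteq> verts ?C \<and> inj_on \<pi> (verts G) \<and>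
           (\<forall>u\<in>verts G. \<forall>v\<in>verts G. u \<rightarrow>\<^bsub>G\<^esub> v \<longleftrightarrow> \<pi> u \<rightarrow>\<^bsub>?C\<^esub> \<pi> v))"
    unfolding derangement_representable_def verts by (intro ex_cong1 conj_cong refl)
  also have "\<dots> \<longleftrightarrow> (\<exists>H. induced_subgraph H ?C \<and> digraph_iso G H)"
    by (rule iso_induced_subgraph_iff_embedding[symmetric])
      (rule G.nomulti_digraph, rule C.nomulti_digraph)
  finally show ?thesis .
qed

end
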